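(* Let $\mathfrak{M}=\langle Ev,IM,IOb,Q,+,\cdot,\le,C,P\rangle$ be a model satisfying all of Borisov's Axioms except possibly Axiom III (that is, satisfying BA1, BA2, BA3, BA4, Axiom I, Axiom II and Axiom IV). Then the set $\mathbb{W}=\{f_{kh}:k,h\in IOb\}$ of worldview transformations is a group under composition satisfying: (i) $\mathrm{Triv}^{\uparrow}_{\mathfrak{Q}}<\mathbb{W}\le\mathrm{Sym}(Q^4)$; (ii) for every $f\in\mathbb{W}$, $f[\mathbf{t}]$ is a line of finite slope; (iii) if $f\in\mathbb{W}$ takes vertical lines to vertical lines, then $f\in\mathrm{Triv}^{\uparrow}_{\mathfrak{Q}}$.
   Context: $H\le G$ means subgroup, $H<G$ proper subgroup; $\mathrm{Sym}(Q^4)$ is the group of all bijections of $Q^4$; $\mathbf{t}=\{(t,0,0,0):t\in Q\}$ is the time-axis. Models. A model is $\mathfrak{M}=\langle Ev,IM,IOb,Q,+,\cdot,\le,C,P\rangle$ with nonempty sets $Ev$ (events), $IM$ (inertial motions), $IOb$ (inertial observers), quantities $\mathfrak{Q}=(Q,+,\cdot,\le)$, and relations $C\subseteq IOb\times Ev\times Q^4$, $P\subseteq IM\times Ev$. For $k\in IOb$ let $C_k=\{(e,\vec p):C(k,e,\vec p)\}$; when all $C_k$ are bijections $Ev\to Q^4$, put $f_{kh}=C_k\circ C_h^{-1}:Q^4\to Q^4$ (worldview transformation) and $\mathrm{wl}_k(i)=C_k[\{e\in Ev: P(i,e)\}]$ (worldline of $i$ according to $k$). For $\vec p=(p_0,p_1,p_2,p_3)\in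 Q^4$, $p_t=p_0$ and $\vec p_s=(p_1,p_2,p_3)$. A line is a set $\{\vec p+\lambda\vec v:\lambda\in Q\}$ with $\vec v\ne 0$; it is vertical if $\vec p_s=\vec q_s$ for all its points $\vec p,\vec q$, and of finite slope if it has points $\vec p,\vec q$ with $p_t\neq q_t$. Motion $i$ is stationary w.r.t. $k$ if $\mathrm{wl}_k(i)$ is a vertical line; $h$ is at rest w.r.t. $k$ if every $i\in IM$ stationary w.r.t. $h$ is stationary w.r.t. $k$. A trivial transformation is a composition of a translation and a linear map $Q^4\to Q^4$ preserving the usual scalar product, which takes vertical lines to vertical lines. $T:Q^4\to Q^4$ is orthochronous if $T(1,0,0,0)_t>T(0,0,0,0)_t$. $\mathrm{Triv}^{\uparrow}_{\mathfrak{Q}}$ is the set (group) of orthochronous trivial transformations. The axioms are: BA1: $\mathfrak{Q}$ is an ordered field. BA2: for every $k\in IOb$, $C_k$ is a bijection $Ev\to Q^4$. BA3: for every vertical line $\ell$ and $k\in IOb$ there is $i\in IM$ with $\mathrm{wl}_k(i)=\ell$. BA4: for all $i\in IM$, $k\in IOb$, $\mathrm{wl}_k(i)$ is a line of finite slope. Axiom I: there are $k,h\in IOb$ with $h$ not at rest w.r.t. $k$. Axiom II: (a) for all $k\in IOb$ and $\varphi\in\mathrm{Triv}^{\uparrow}_{\mathfrak{Q}}$ there is $h\in IOb$ with $f_{kh}=\varphi$; (b) for all $k,h\in IOb$, if $h$ is at rest w.r.t. $k$ then $f_{kh}\in\mathrm{Triv}^{\uparrow}_{\mathfrak{Q}}$.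 Axiom III (not assumed here): for all $i\in IM$, $k\in IOb$, $\varphi\in\mathrm{Triv}^{\uparrow}_{\mathfrak{Q}}$ there is $i'\in IM$ with $\mathrm{wl}_k(i')=\varphi[\mathrm{wl}_k(i)]$. Axiom IV: for all $k,k',h\in IOb$ there is $h'\in IOb$ with $f_{hh'}=f_{kk'}$. *)

theory Defs
  imports "HOL-Analysis.Cartesian_Space" "HOL-Algebra.Bij"
begin

text \<open>
  Coordinate points are vectors of type \<open>'q ^ 4\<close>. The index type \<open>4\<close> has exactly the
  elements \<open>0, 1, 2, 3\<close> (numeral type, \<open>4 = 0\<close>), so \<open>p $ 0\<close> is the time coordinate and
  \<open>p $ 1, p $ 2, p $ 3\<close> are the space coordinates.
\<close>

definition time_part :: "'q ^ 4 \<Rightarrow> 'q" where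
  "time_part p = p $ 0"

definition space_part :: "'q ^ 4 \<Rightarrow> 'q \<times> 'q \<times> 'q" where
  "space_part p = (p $ 1, p $ 2, p $ 3)"

definition time_axis :: "('q::linordered_field ^ 4) set" where
  "time_axis = {axis 0 t | t. True}"

definition is_line :: "('q::linordered_field ^ 4) set \<Rightarrow> bool" where
  "is_line l \<longleftrightarrow> (\<exists>p v. v \<noteq> 0 \<and> l = {p + c *s v | c. True})"

definition vertical_line :: "('q::linordered_field ^ 4) set \<Rightarrow> bool" where
  "vertical_line l \<longleftrightarrow> is_line l \<and> (\<forall>p\<in>l. \<forall>q\<in>l. space_part p = space_part q)"

definition finite_slope_line :: "('q::linordered_field ^ 4) set \<Rightarrow> bool" where
  "finite_slope_line l \<longleftrightarrow> is_line l \<and> (\<exists>p\<in>l. \<exists>q\<in>l. time_part p \<noteq> time_part q)"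

definition preserves_vertical_lines ::
    "('q::linordered_field ^ 4 \<Rightarrow> 'q ^ 4) \<Rightarrow> bool" where
  "preserves_vertical_lines f \<longleftrightarrow> (\<forall>l. vertical_line l \<longrightarrow> vertical_line (f ` l))"

text \<open>The library's \<open>inner\<close> is real-valued, so it is not available over a general field.\<close>

definition scalar_prod :: "'q::linordered_field ^ 4 \<Rightarrow> 'q ^ 4 \<Rightarrow> 'q" where
  "scalar_prod u v = (\<Sum>j\<in>UNIV. u $ j * v $ j)"

definition trivial_trafo :: "('q::linordered_field ^ 4 \<Rightarrow> 'q ^ 4) \<Rightarrow> bool" where
  "trivial_trafo T \<longleftrightarrow>
     (\<exists>a L. Vector_Spaces.linear (*s) (*s) L \<and>
            (\<forall>u v. scalar_prod (L u) (L v) = scalar_prod u v) \<and>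
            T = (\<lambda>p. p + a) \<circ> L) \<and>
     preserves_vertical_lines T"

definition orthochronous :: "('q::linordered_field ^ 4 \<Rightarrow> 'q ^ 4) \<Rightarrow> bool" where
  "orthochronous T \<longleftrightarrow> time_part (T (axis 0 1)) > time_part (T 0)"

definition Triv_up :: "('q::linordered_field ^ 4 \<Rightarrow> 'q ^ 4) set" where
  "Triv_up = {T. trivial_trafo T \<and> orthochronous T}"

text \<open>
  BA1 (the quantities form an ordered field) is the class constraint
  \<open>linordered_field\<close> on \<open>'q\<close>.
\<close>

record ('e, 'i, 'o, 'q) structure4 =
  Ev :: "'e set"
  IM :: "'i set"
  IOb :: "'o set"
  CRel :: "('o \<times> 'e \<times> ('q ^ 4)) set"
  PRel :: "('i \<times> 'e) set"

definition is_model :: "('e, 'i, 'o, 'q::linordered_field) structure4 \<Rightarrow> bool" where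
  "is_model M \<longleftrightarrow>
     Ev M \<noteq> {} \<and> IM M \<noteq> {} \<and> IOb M \<noteq> {} \<and>
     CRel M \<subseteq> IOb M \<times> Ev M \<times> UNIV \<and> PRel M \<subseteq> IM M \<times> Ev M"

definition coord_rel ::
    "('e, 'i, 'o, 'q::linordered_field) structure4 \<Rightarrow> 'o \<Rightarrow> ('e \<times> ('q ^ 4)) set" where
  "coord_rel M k = {(e, p). (k, e, p) \<in> CRel M}"

text \<open>
  The relational composition \<open>O\<close> is written in diagrammatic order, so the relation below is
  \<open>C\<^sub>k \<circ> C\<^sub>h\<^sup>-\<^sup>1\<close>; it is the graph of a function when all coordinate relations are bijections.
\<close>

definition worldview_trafo ::
    "('e, 'i, 'o, 'q::linordered_field) structure4 \<Rightarrow> 'o \<Rightarrow> 'o \<Rightarrow> 'q ^ 4 \<Rightarrow> 'q ^ 4" where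
  "worldview_trafo M k h p = (THE q. (p, q) \<in> (coord_rel M h)\<inverse> O coord_rel M k)"

definition worldview_trafos ::
    "('e, 'i, 'o, 'q::linordered_field) structure4 \<Rightarrow> ('q ^ 4 \<Rightarrow> 'q ^ 4) set" where
  "worldview_trafos M = {worldview_trafo M k h | k h. k \<in> IOb M \<and> h \<in> IOb M}"

definition worldline ::
    "('e, 'i, 'o, 'q::linordered_field) structure4 \<Rightarrow> 'o \<Rightarrow> 'i \<Rightarrow> ('q ^ 4) set" where
  "worldline M k i = coord_rel M k `` {e \<in> Ev M. (i, e) \<in> PRel M}"

definition stationary ::
    "('e, 'i, 'o, 'q::linordered_field) structure4 \<Rightarrow> 'i \<Rightarrow> 'o \<Rightarrow> bool" where
  "stationary M i k \<longleftrightarrow> vertical_line (worldline M k i)"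

text \<open>\<open>at_rest M h k\<close>: the observer \<open>h\<close> is at rest with respect to \<open>k\<close>.\<close>

definition at_rest ::
    "('e, 'i, 'o, 'q::linordered_field) structure4 \<Rightarrow> 'o \<Rightarrow> 'o \<Rightarrow> bool" where
  "at_rest M h k \<longleftrightarrow> (\<forall>i\<in>IM M. stationary M i h \<longrightarrow> stationary M i k)"

definition BA2 :: "('e, 'i, 'o, 'q::linordered_field) structure4 \<Rightarrow> bool" where
  "BA2 M \<longleftrightarrow>
     (\<forall>k\<in>IOb M. \<exists>g. bij_betw g (Ev M) UNIV \<and> coord_rel M k = {(e, g e) | e. e \<in> Ev M})"

definition BA3 :: "('e, 'i, 'o, 'q::linordered_field) structure4 \<Rightarrow> bool" where
  "BA3 M \<longleftrightarrow>
     (\<forall>l. \<forall>k\<in>IOb M. vertical_line l \<longrightarrow> (\<exists>i\<in>IM M. worldline M k i = l))"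

definition BA4 :: "('e, 'i, 'o, 'q::linordered_field) structure4 \<Rightarrow> bool" where
  "BA4 M \<longleftrightarrow> (\<forall>i\<in>IM M. \<forall>k\<in>IOb M. finite_slope_line (worldline M k i))"

definition Axiom_I :: "('e, 'i, 'o, 'q::linordered_field) structure4 \<Rightarrow> bool" where
  "Axiom_I M \<longleftrightarrow> (\<exists>k\<in>IOb M. \<exists>h\<in>IOb M. \<not> at_rest M h k)"

definition Axiom_II :: "('e, 'i, 'o, 'q::linordered_field) structure4 \<Rightarrow> bool" where
  "Axiom_II M \<longleftrightarrow>
     (\<forall>k\<in>IOb M. \<forall>\<phi>\<in>Triv_up. \<exists>h\<in>IOb M. worldview_trafo M k h = \<phi>) \<and>
     (\<forall>k\<in>IOb M. \<forall>h\<in>IOb M. at_rest M h k \<longrightarrow> worldview_trafo M k h \<in> Triv_up)"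

definition Axiom_IV :: "('e, 'i, 'o, 'q::linordered_field) structure4 \<Rightarrow> bool" where
  "Axiom_IV M \<longleftrightarrow>
     (\<forall>k\<in>IOb M. \<forall>k'\<in>IOb M. \<forall>h\<in>IOb M. \<exists>h'\<in>IOb M.
        worldview_trafo M h h' = worldview_trafo M k k')"

abbreviation Sym_Q4 :: "('q::linordered_field ^ 4 \<Rightarrow> 'q ^ 4) monoid" where
  "Sym_Q4 \<equiv> BijGroup UNIV"

end

theory Submission
  imports Defs
begin

text \<open>
  Axiom IV turns the cocycle rule \<open>f\<^sub>k\<^sub>h \<circ> f\<^sub>h\<^sub>l = f\<^sub>k\<^sub>l\<close> into closure of the worldview transformations
  under composition. By BA3, a transformation \<open>f\<^sub>k\<^sub>h\<close> preserving vertical lines puts \<open>h\<close> at rest with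
  respect to \<open>k\<close>, so Axiom II (b) identifies the orthochronous trivial transformations as exactly
  the worldview transformations that preserve vertical lines. Preserving vertical lines is stable
  under composition, and also under inverses since the vertical lines partition the space, so the
  trivial transformations form a subgroup without any computation with linear maps.
\<close>

section \<open>Vertical lines as the fibres of the spatial projection\<close>

lemma vec4_eq_iff: "(p::'q ^ 4) = q \<longleftrightarrow> time_part p = time_part q \<and> space_part p = space_part q"
proof -
  \<comment> \<open>\<open>forall_4\<close> enumerates the indices as 1, 2, 3, 4, so the time
    coordinate first appears as component 4.\<close>
  have "(4::4) = 0" by simp
  then have "p $ 4 = p $ 0" "q $ 4 = q $ 0" by metis+
  then show ?thesis
    by (auto simp: vec_eq_iff forall_4 time_part_def space_part_def)
qed

text \<open>A direction vector of a vertical line has zero space part, so its time coordinate is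
  nonzero and, over a field, its multiples reach every time. As fibres of \<open>space_part\<close>,
  vertical lines are equivalence classes, hence a partition.\<close>

lemma vertical_line_iff_fibre:
  "vertical_line l \<longleftrightarrow> (\<exists>p. l = {q. space_part q = space_part p})"
proof
  assume l: "vertical_line l"
  then obtain p v where v: "v \<noteq> 0" and l_eq: "l = {p + c *s v | c. True}"
    unfolding vertical_line_def is_line_def by blast
  have "p \<in> l" "p + v \<in> l"
    unfolding l_eq by (auto intro: exI[of _ 0] exI[of _ 1])
  then have "space_part (p + v) = space_part p"
    using l unfolding vertical_line_def by blast
  then have sv: "v $ 1 = 0" "v $ 2 = 0" "v $ 3 = 0"
    by (auto simp: space_part_def)
  then have tv: "v $ 0 \<noteq> 0"
    using v vec4_eq_iff[of v 0] by (auto simp: space_part_def time_part_def)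
  have "q \<in> l" if "space_part q = space_part p" for q
  proof -
    \<comment> \<open>The coefficient solves the equation of time coordinates; \<open>tv\<close>
      makes the division legitimate.\<close>
    have "q = p + ((q $ 0 - p $ 0) / v $ 0) *s v"
      using that sv tv by (auto simp: vec4_eq_iff space_part_def time_part_def)
    then show ?thesis
      unfolding l_eq by blast
  qed
  moreover have "space_part q = space_part p" if "q \<in> l" for q
    using that l \<open>p \<in> l\<close> unfolding vertical_line_def by blast
  ultimately show "\<exists>p. l = {q. space_part q = space_part p}"
    by blast
next
  assume "\<exists>p. l = {q. space_part q = space_part p}"
  then obtain p where l: "l = {q. space_part q = space_part p}" by blast
  have "q \<in> {p + c *s axis 0 1 | c. True} \<longleftrightarrow> q \<in> l" for q
  proof
    assume "q \<in> l"
    then have "q = p + (q $ 0 - p $ 0) *s axis 0 1"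
      by (auto simp: l vec4_eq_iff space_part_def time_part_def axis_def)
    then show "q \<in> {p + c *s axis 0 1 | c. True}"
      by blast
  qed (auto simp: l space_part_def axis_def)
  then have "l = {p + c *s axis 0 1 | c. True}"
    by blast
  moreover have "axis 0 1 \<noteq> (0 :: 'a ^ 4)"
    by (simp add: axis_eq_0_iff)
  ultimately have "is_line l"
    unfolding is_line_def by blast
  then show "vertical_line l"
    unfolding vertical_line_def by (auto simp: l)
qed

lemma vertical_lines_eq:
  assumes "vertical_line l" "vertical_line l'" "p \<in> l" "p \<in> l'"
  shows "l = l'"
  using assms unfolding vertical_line_iff_fibre by auto

lemma vertical_line_through:
  obtains l where "vertical_line l" "p \<in> l"
  unfolding vertical_line_iff_fibre by blast

lemma vertical_line_time_axis: "vertical_line (time_axis :: ('q::linordered_field ^ 4) set)"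
proof -
  have "q \<in> time_axis \<longleftrightarrow> space_part q = space_part 0" for q :: "'q ^ 4"
    by (auto simp: time_axis_def vec4_eq_iff space_part_def time_part_def axis_def)
  then show ?thesis
    unfolding vertical_line_iff_fibre by blast
qed

lemma preserves_vertical_lines_comp:
  "preserves_vertical_lines f \<Longrightarrow> preserves_vertical_lines g \<Longrightarrow> preserves_vertical_lines (f \<circ> g)"
  unfolding preserves_vertical_lines_def by (metis image_comp)

text \<open>For \<open>p\<close> on a vertical line \<open>l\<close>, the vertical line
  \<open>l'\<close> through the preimage of \<open>p\<close> has a vertical image that meets
  \<open>l\<close> in \<open>p\<close>. Distinct vertical lines are disjoint, so this image is
  \<open>l\<close>, and the inverse sends \<open>l\<close> back to \<open>l'\<close>.\<close>

lemma preserves_vertical_lines_inv: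
  assumes "bij f" and f: "preserves_vertical_lines f"
  shows "preserves_vertical_lines (inv_into UNIV f)"
  unfolding preserves_vertical_lines_def
proof (intro allI impI)
  fix l :: "('a ^ 4) set"
  assume l: "vertical_line l"
  then obtain p where p: "p \<in> l"
    unfolding vertical_line_iff_fibre by blast
  obtain l' where l': "vertical_line l'" "inv_into UNIV f p \<in> l'"
    by (rule vertical_line_through)
  have "p = f (inv_into UNIV f p)"
    using \<open>bij f\<close> by (simp add: bij_is_surj surj_f_inv_f)
  then have "p \<in> f ` l'"
    using l'(2) by blast
  then have "l = f ` l'"
    using vertical_lines_eq l p l'(1) f unfolding preserves_vertical_lines_def by blast
  then have "inv_into UNIV f ` l = l'"
    using \<open>bij f\<close> by (simp add: image_inv_f_f bij_is_inj)
  then show "vertical_line (inv_into UNIV f ` l)"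
    using l'(1) by simp
qed

section \<open>Coordinate functions and the cocycle rule\<close>

definition coord :: "('e, 'i, 'o, 'q::linordered_field) structure4 \<Rightarrow> 'o \<Rightarrow> 'e \<Rightarrow> 'q ^ 4" where
  "coord M k e = (THE p. (e, p) \<in> coord_rel M k)"

context
  fixes M :: "('e, 'i, 'o, 'q::linordered_field) structure4"
  assumes BA2: "BA2 M"
begin

lemma coord_props:
  assumes "k \<in> IOb M"
  shows bij_betw_coord: "bij_betw (coord M k) (Ev M) UNIV"
    and coord_rel_eq: "coord_rel M k = {(e, coord M k e) | e. e \<in> Ev M}"
proof -
  obtain g where g: "bij_betw g (Ev M) UNIV" "coord_rel M k = {(e, g e) | e. e \<in> Ev M}"
    using BA2 assms unfolding BA2_def by blast
  \<comment> \<open>Outside \<open>Ev M\<close> the description in \<open>coord\<close> has no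
    candidate, so agreement with \<open>g\<close> is claimed on events only.\<close>
  have eq: "coord M k e = g e" if "e \<in> Ev M" for e
    using that by (auto simp: coord_def g(2))
  show "bij_betw (coord M k) (Ev M) UNIV"
    using g(1) eq bij_betw_cong by blast
  show "coord_rel M k = {(e, coord M k e) | e. e \<in> Ev M}"
    using g(2) eq by force
qed

lemma coord_surj:
  assumes "k \<in> IOb M"
  obtains e where "e \<in> Ev M" "p = coord M k e"
  using bij_betw_coord[OF assms] by (metis UNIV_I bij_betw_imp_surj_on imageE)

text \<open>This eliminates the definite description: since every point is the coordinate of some
  event, later identities are checked event by event.\<close>

lemma worldview_trafo_coord:
  assumes "k \<in> IOb M" "h \<in> IOb M" "e \<in> Ev M"
  shows "worldview_trafo M k h (coord M h e) = coord M k e"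
  unfolding worldview_trafo_def
proof (rule the_equality)
  show "(coord M h e, coord M k e) \<in> (coord_rel M h)\<inverse> O coord_rel M k"
    using assms by (auto simp: coord_rel_eq)
next
  fix q assume "(coord M h e, q) \<in> (coord_rel M h)\<inverse> O coord_rel M k"
  then obtain e' where "e' \<in> Ev M" "coord M h e = coord M h e'" "q = coord M k e'"
    using assms by (auto simp: coord_rel_eq)
  then show "q = coord M k e"
    \<comment> \<open>Injectivity of \<open>coord M h\<close> forces \<open>e' = e\<close>.\<close>
    using bij_betw_coord[OF assms(2)] assms(3) by (metis bij_betw_imp_inj_on inj_onD)
qed

lemma worldview_trafo_comp:
  assumes "k \<in> IOb M" "h \<in> IOb M" "l \<in> IOb M"
  shows "worldview_trafo M k h \<circ> worldview_trafo M h l = worldview_trafo M k l"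
proof
  fix p
  obtain e where "e \<in> Ev M" "p = coord M l e"
    using coord_surj assms by blast
  then show "(worldview_trafo M k h \<circ> worldview_trafo M h l) p = worldview_trafo M k l p"
    using assms by (simp add: worldview_trafo_coord)
qed

lemma worldview_trafo_self:
  assumes "k \<in> IOb M"
  shows "worldview_trafo M k k = id"
proof
  fix p
  obtain e where "e \<in> Ev M" "p = coord M k e"
    using coord_surj assms by blast
  then show "worldview_trafo M k k p = id p"
    using assms by (simp add: worldview_trafo_coord)
qed

lemma
  assumes "k \<in> IOb M" "h \<in> IOb M"
  shows bij_worldview_trafo: "bij (worldview_trafo M k h)"
    and inv_worldview_trafo: "inv_into UNIV (worldview_trafo M k h) = worldview_trafo M h k"
proof -
  have comps: "worldview_trafo M k h \<circ> worldview_trafo M h k = id"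
    "worldview_trafo M h k \<circ> worldview_trafo M k h = id"
    using assms by (simp_all add: worldview_trafo_comp worldview_trafo_self)
  then show "bij (worldview_trafo M k h)"
    using o_bij by blast
  show "inv_into UNIV (worldview_trafo M k h) = worldview_trafo M h k"
    using comps by (metis inv_unique_comp)
qed

lemma worldline_image:
  assumes "k \<in> IOb M" "h \<in> IOb M"
  shows "worldline M k i = worldview_trafo M k h ` worldline M h i"
proof -
  have wl: "worldline M k i = coord M k ` {e \<in> Ev M. (i, e) \<in> PRel M}" if "k \<in> IOb M" for k
    using that by (auto simp: worldline_def coord_rel_eq)
  show ?thesis
    using assms by (force simp: wl image_image worldview_trafo_coord)
qed

text \<open>Worldlines for \<open>k\<close> are the images of worldlines for \<open>h\<close>. From
  left to right, BA3 realises every vertical line as the worldline, for \<open>h\<close>, of some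
  inertial motion.\<close>

lemma at_rest_iff:
  assumes "BA3 M" "k \<in> IOb M" "h \<in> IOb M"
  shows "at_rest M h k \<longleftrightarrow> preserves_vertical_lines (worldview_trafo M k h)"
  using assms worldline_image[OF assms(2,3)]
  unfolding at_rest_def stationary_def preserves_vertical_lines_def BA3_def by metis

section \<open>Subgroups of the symmetric group\<close>

lemma subgroup_worldview_trafos:
  assumes "IOb M \<noteq> {}" "Axiom_IV M"
  shows "subgroup (worldview_trafos M) Sym_Q4"
proof -
  interpret Sym: group "Sym_Q4 :: ('q ^ 4 \<Rightarrow> 'q ^ 4) monoid"
    by (rule group_BijGroup)
  have Bij: "f \<in> Bij UNIV" if "f \<in> worldview_trafos M" for f
    using that bij_worldview_trafo by (auto simp: worldview_trafos_def Bij_def)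
  show ?thesis
  proof (rule Sym.subgroupI)
    show "worldview_trafos M \<subseteq> carrier Sym_Q4"
      using Bij by (auto simp: BijGroup_def)
    show "worldview_trafos M \<noteq> {}"
      using assms by (auto simp: worldview_trafos_def)
  next
    fix f assume f: "f \<in> worldview_trafos M"
    \<comment> \<open>The operations of \<open>BijGroup\<close> are restricted to the underlying
      set; over \<open>UNIV\<close> they are the ordinary inverse and, below, the ordinary
      composition.\<close>
    then have "inv\<^bsub>Sym_Q4\<^esub> f = inv_into UNIV f"
      using Bij by (simp add: inv_BijGroup restrict_def)
    also have "\<dots> \<in> worldview_trafos M"
      using f inv_worldview_trafo by (auto simp: worldview_trafos_def)
    finally show "inv\<^bsub>Sym_Q4\<^esub> f \<in> worldview_trafos M" .
  next
    fix f g assume f: "f \<in> worldview_trafos M" and g: "g \<in> worldview_trafos M"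
    then obtain k h k' h' where kh: "k \<in> IOb M" "h \<in> IOb M" "k' \<in> IOb M" "h' \<in> IOb M"
      and fg: "f = worldview_trafo M k h" "g = worldview_trafo M k' h'"
      unfolding worldview_trafos_def by blast
    \<comment> \<open>Axiom IV re-bases \<open>g\<close> at the observer \<open>h\<close>, so that
      the cocycle rule applies to \<open>f \<circ> g\<close>.\<close>
    obtain l where l: "l \<in> IOb M" "worldview_trafo M h l = g"
      using assms(2) kh fg(2) unfolding Axiom_IV_def by metis
    have "f \<otimes>\<^bsub>Sym_Q4\<^esub> g = f \<circ> g"
      using Bij f g by (simp add: BijGroup_def compose_def fun_eq_iff)
    also have "\<dots> = worldview_trafo M k l"
      using worldview_trafo_comp kh l fg(1) by metis
    also have "\<dots> \<in> worldview_trafos M"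
      using kh l by (auto simp: worldview_trafos_def)
    finally show "f \<otimes>\<^bsub>Sym_Q4\<^esub> g \<in> worldview_trafos M" .
  qed
qed

text \<open>Axiom II (a), applied at any observer, realises each trivial transformation. Conversely,
  preservation of vertical lines means being at rest, and Axiom II (b) applies.\<close>

lemma Triv_up_eq:
  assumes "IOb M \<noteq> {}" "BA3 M" "Axiom_II M"
  shows "Triv_up = {f \<in> worldview_trafos M. preserves_vertical_lines f}"
proof
  show "Triv_up \<subseteq> {f \<in> worldview_trafos M. preserves_vertical_lines f}"
  proof
    fix f :: "'q ^ 4 \<Rightarrow> 'q ^ 4" assume f: "f \<in> Triv_up"
    then have "preserves_vertical_lines f"
      by (simp add: Triv_up_def trivial_trafo_def)
    moreover have "f \<in> worldview_trafos M"
      using assms(1,3) f unfolding Axiom_II_def worldview_trafos_def by fast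
    ultimately show "f \<in> {f \<in> worldview_trafos M. preserves_vertical_lines f}"
      by simp
  qed
  show "{f \<in> worldview_trafos M. preserves_vertical_lines f} \<subseteq> Triv_up"
    using assms(2,3) at_rest_iff unfolding Axiom_II_def worldview_trafos_def by blast
qed

text \<open>By \<open>Triv_up_eq\<close>, each closure condition splits into closure of
  \<open>worldview_trafos M\<close> and stability of preserving vertical lines.\<close>

lemma subgroup_Triv_up:
  assumes "IOb M \<noteq> {}" "BA3 M" "Axiom_II M" "Axiom_IV M"
  shows "subgroup Triv_up (Sym_Q4 :: ('q ^ 4 \<Rightarrow> 'q ^ 4) monoid)"
proof -
  interpret Sym: group "Sym_Q4 :: ('q ^ 4 \<Rightarrow> 'q ^ 4) monoid"
    by (rule group_BijGroup)
  interpret W: subgroup "worldview_trafos M" Sym_Q4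
    using subgroup_worldview_trafos assms by blast
  have carrier: "carrier Sym_Q4 = Bij (UNIV :: ('q ^ 4) set)"
    by (simp add: BijGroup_def)
  have one: "\<one>\<^bsub>Sym_Q4\<^esub> = (id :: 'q ^ 4 \<Rightarrow> 'q ^ 4)"
    by (auto simp: BijGroup_def)
  have "(id :: 'q ^ 4 \<Rightarrow> 'q ^ 4) \<in> Triv_up"
    using W.one_closed one by (simp add: Triv_up_eq[OF assms(1-3)] preserves_vertical_lines_def)
  show ?thesis
  proof (rule Sym.subgroupI)
    show "Triv_up \<subseteq> carrier (Sym_Q4 :: ('q ^ 4 \<Rightarrow> 'q ^ 4) monoid)"
      using W.subset Triv_up_eq[OF assms(1-3)] by blast
    show "(Triv_up :: ('q ^ 4 \<Rightarrow> 'q ^ 4) set) \<noteq> {}"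
      using \<open>id \<in> Triv_up\<close> by blast
  next
    fix f :: "'q ^ 4 \<Rightarrow> 'q ^ 4" assume f: "f \<in> Triv_up"
    then have fW: "f \<in> worldview_trafos M" and fv: "preserves_vertical_lines f"
      by (auto simp: Triv_up_eq[OF assms(1-3)])
    have "f \<in> Bij UNIV"
      using fW W.subset carrier by blast
    then have "inv\<^bsub>Sym_Q4\<^esub> f = inv_into UNIV f" "bij f"
      by (simp_all add: inv_BijGroup Bij_def restrict_def)
    then show "inv\<^bsub>Sym_Q4\<^esub> f \<in> Triv_up"
      using preserves_vertical_lines_inv fv W.m_inv_closed[OF fW]
      by (simp add: Triv_up_eq[OF assms(1-3)])
  next
    fix f g :: "'q ^ 4 \<Rightarrow> 'q ^ 4" assume f: "f \<in> Triv_up" and g: "g \<in> Triv_up"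
    then have fW: "f \<in> worldview_trafos M" and gW: "g \<in> worldview_trafos M"
      and v: "preserves_vertical_lines (f \<circ> g)"
      by (auto simp: Triv_up_eq[OF assms(1-3)] preserves_vertical_lines_comp)
    have "f \<in> Bij UNIV" "g \<in> Bij UNIV"
      using fW gW W.subset carrier by blast+
    then have "f \<otimes>\<^bsub>Sym_Q4\<^esub> g = f \<circ> g"
      by (simp add: BijGroup_def compose_def fun_eq_iff)
    then show "f \<otimes>\<^bsub>Sym_Q4\<^esub> g \<in> Triv_up"
      using v W.m_closed[OF fW gW] by (simp add: Triv_up_eq[OF assms(1-3)])
  qed
qed

end

theorem theorem10:
  fixes M :: "('e, 'i, 'o, 'q::linordered_field) structure4"
  assumes "is_model M"
    and "BA2 M" and "BA3 M" and "BA4 M"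
    and "Axiom_I M" and "Axiom_II M" and "Axiom_IV M"
  shows "group (Sym_Q4\<lparr>carrier := worldview_trafos M\<rparr>) \<and>
    (subgroup Triv_up (Sym_Q4\<lparr>carrier := worldview_trafos M\<rparr>) \<and>
      Triv_up \<subset> worldview_trafos M \<and>
      subgroup (worldview_trafos M) Sym_Q4) \<and>
    (\<forall>f\<in>worldview_trafos M. finite_slope_line (f ` time_axis)) \<and>
    (\<forall>f\<in>worldview_trafos M. preserves_vertical_lines f \<longrightarrow> f \<in> Triv_up)"
proof -
  have ne: "IOb M \<noteq> {}"
    using assms(1) by (simp add: is_model_def)
  note Triv = Triv_up_eq[OF assms(2) ne assms(3,6)]
  have G: "group (Sym_Q4 :: ('q ^ 4 \<Rightarrow> 'q ^ 4) monoid)"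
    by (rule group_BijGroup)
  have W: "subgroup (worldview_trafos M) Sym_Q4"
    by (rule subgroup_worldview_trafos[OF assms(2) ne assms(7)])
  have T: "subgroup Triv_up (Sym_Q4 :: ('q ^ 4 \<Rightarrow> 'q ^ 4) monoid)"
    by (rule subgroup_Triv_up[OF assms(2) ne assms(3,6,7)])
  have sub: "Triv_up \<subseteq> worldview_trafos M"
    using Triv by blast
  \<comment> \<open>Axiom I supplies the witness for strictness: the transformation between these
    observers does not preserve vertical lines.\<close>
  obtain k h where kh: "k \<in> IOb M" "h \<in> IOb M" "\<not> at_rest M h k"
    using assms(5) unfolding Axiom_I_def by blast
  then have "worldview_trafo M k h \<in> worldview_trafos M" "worldview_trafo M k h \<notin> Triv_up"
    using at_rest_iff[OF assms(2,3)] Triv by (auto simp: worldview_trafos_def)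
  then have strict: "Triv_up \<subset> worldview_trafos M"
    using sub by blast
  have slope: "finite_slope_line (f ` time_axis)" if f: "f \<in> worldview_trafos M" for f
  proof -
    obtain k h where kh: "k \<in> IOb M" "h \<in> IOb M" and f: "f = worldview_trafo M k h"
      using f unfolding worldview_trafos_def by blast
    \<comment> \<open>The image of the time axis is recognised as the worldline for \<open>k\<close>
      of a motion whose worldline for \<open>h\<close> is that axis, so BA4 gives its finite
      slope.\<close>
    obtain i where i: "i \<in> IM M" "worldline M h i = time_axis"
      using assms(3) kh(2) vertical_line_time_axis unfolding BA3_def by blast
    have "f ` time_axis = worldline M k i"
      using worldline_image[OF assms(2) kh, of i] i(2) f by simp
    then show ?thesis
      using assms(4) i(1) kh(1) unfolding BA4_def by simp
  qed
  show ?thesis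
    using group.subgroup_imp_group[OF G W] group.subgroup_incl[OF G T W sub] strict W slope Triv
    by blast
qed

end
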